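(* Let $I\subseteq\mathbb R$ be an interval, let $l, m, n, \alpha : I \to \mathbb R$ be smooth functions and let $\delta_1, \delta_2 \in \{1, -1\}$ be constants. Then there exists a non-parabolic spatial hybrid framed curve $(\gamma, \bm\nu_1, \bm\nu_2) : I \to \mathbb H^p \times \Delta$ whose curvature is $(l, m, n, \alpha)$ and which satisfies $g(\bm\nu_1(t), \bm\nu_1(t)) = \delta_1$ and $g(\bm\nu_2(t), \bm\nu_2(t)) = \delta_2$ for all $t\in I$. The curve is unique up to spatial hybrid motions: any two non-parabolic spatial hybrid framed curves $I \to \mathbb H^p\times\Delta$ with these properties are congruent through a spatial hybrid motion.
   Context: All maps are $C^\infty$. $\mathbb H^p = \{b\bm i + c\bm\varepsilon + d\bm h : b,c,d\in\mathbb R\}$ is the 3-dimensional real vector space with basis $\{\bm i,\bm\varepsilon,\bm h\}$, identified with $\mathbb R^3$ (column vectors $(b,c,d)^T$). For $\bm H_k = b_k \bm i + c_k \bm\varepsilon + d_k \bm h$, the scalar product is $g(\bm H_1,\bm H_2) = b_1b_2 - b_1c_2 - b_2c_1 - d_1d_2 = \bm H_1^TG\bm H_2$, where $G = \begin{pmatrix} 1 & -1 & 0\\ -1 & 0 & 0\\ 0 & 0 & -1 \end{pmatrix}$; the norm is $\|\bm H\| = \sqrt{|g(\bm H,\bm H)|}$; the vector product is $$\bm H_1 \times \bm H_2 = (b_2d_1 - b_1d_2)\bm i + (b_2d_1 - b_1d_2 - c_2d_1 + c_1d_2)\bm\varepsilon + (b_1c_2 - b_2c_1)\bm h.$$ Let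 $\Delta = \{(\bm\nu_1, \bm\nu_2) \in \mathbb H^p \times \mathbb H^p : \|\bm\nu_1\| = \|\bm\nu_2\| = 1,\ g(\bm\nu_1, \bm\nu_2) = 0\}$. Non-parabolic spatial hybrid framed curve: a smooth map $(\gamma, \bm\nu_1, \bm\nu_2) : I \to \mathbb H^p \times \Delta$ with $g(\gamma'(t), \bm\nu_1(t)) = g(\gamma'(t), \bm\nu_2(t)) = 0$ for all $t \in I$. Put $\bm\mu = \bm\nu_1\times\bm\nu_2$, $\delta_1 = g(\bm\nu_1,\bm\nu_1)$, $\delta_2 = g(\bm\nu_2,\bm\nu_2)$ (constants in $\{1,-1\}$). Its curvature is $(l,m,n,\alpha): I\to\mathbb R^4$, where $$l = \delta_2 g(\bm\nu_1',\bm\nu_2),\quad m = \delta_1\delta_2 g(\bm\nu_1',\bm\mu),\quad n = \delta_1\delta_2 g(\bm\nu_2',\bm\mu),\quad \alpha = \delta_1\delta_2 g(\gamma',\bm\mu);$$ equivalently $\gamma' = \alpha\bm\mu$, $\bm\nu_1' = l\bm\nu_2 + m\bm\mu$, $\bm\nu_2' = -\delta_1\delta_2 l\bm\nu_1 + n\bm\mu$, $\bm\mu' = -\delta_2 m\bm\nu_1 - \delta_1 n\bm\nu_2$. Spatial hybrid motions: $\mathcal G = \{A\in\mathbb R^{3\times3} : A^TGA = G,\ \det A = 1\}$. Two non-parabolic spatial hybrid framed curves $(\gamma,\bm\nu_1,\bm\nu_2)$ and $(\tilde\gamma,\tilde{\bm\nu}_1,\tilde{\bm\nu}_2)$ on $I$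 are congruent through a spatial hybrid motion if there exist $A\in\mathcal G$ and $\bm H_0\in\mathbb H^p$ such that $\tilde\gamma(t) = A(\gamma(t)) + \bm H_0$, $\tilde{\bm\nu}_1(t) = A(\bm\nu_1(t))$, $\tilde{\bm\nu}_2(t) = A(\bm\nu_2(t))$ for all $t\in I$.
   Formalization: Existence is stated only for (δ1, δ2) ≠ (1, 1): g has signature (1,2), so no g-orthogonal ν1, ν2 both have g(ν,ν) = 1 and the claim fails there. Uniqueness is stated for all signs. The interval I is taken to be non-degenerate. *)

theory Defs
  imports "HOL-Analysis.Analysis"
begin

text \<open>All derivatives are taken within \<open>I\<close>, hence one-sided at endpoints belonging to \<open>I\<close>.
  They are meaningful when \<open>I\<close> is a non-degenerate interval.\<close>

definition deriv_on :: "real set \<Rightarrow> (real \<Rightarrow> 'a::real_normed_vector) \<Rightarrow> real \<Rightarrow> 'a" where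
  "deriv_on I f t = vector_derivative f (at t within I)"

definition smooth_on :: "real set \<Rightarrow> (real \<Rightarrow> 'a::real_normed_vector) \<Rightarrow> bool" where
  "smooth_on I f \<longleftrightarrow> (\<forall>k. (deriv_on I ^^ k) f differentiable_on I)"

text \<open>The hybrid vector \<open>b i + c \<epsilon> + d h\<close> is the column vector \<open>vector [b, c, d]\<close>.\<close>

type_synonym hvec = "real^3"

definition hprod :: "hvec \<Rightarrow> hvec \<Rightarrow> real" where
  "hprod x y = x$1 * y$1 - x$1 * y$2 - x$2 * y$1 - x$3 * y$3"

definition Gmat :: "real^3^3" where
  "Gmat = vector [vector [1, -1, 0], vector [-1, 0, 0], vector [0, 0, -1]]"

lemma hprod_eq_Gmat: "hprod x y = x \<bullet> (Gmat *v y)"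
  by (simp add: hprod_def Gmat_def inner_vec_def sum_3 matrix_vector_mult_def algebra_simps)

definition hnorm :: "hvec \<Rightarrow> real" where
  "hnorm x = sqrt \<bar>hprod x x\<bar>"

definition hcross :: "hvec \<Rightarrow> hvec \<Rightarrow> hvec" where
  "hcross x y = vector
     [y$1 * x$3 - x$1 * y$3,
      y$1 * x$3 - x$1 * y$3 - y$2 * x$3 + x$2 * y$3,
      x$1 * y$2 - y$1 * x$2]"

definition Delta :: "(hvec \<times> hvec) set" where
  "Delta = {(v1, v2). hnorm v1 = 1 \<and> hnorm v2 = 1 \<and> hprod v1 v2 = 0}"

text \<open>The form \<open>hprod x x = (b - c)\<^sup>2 - c\<^sup>2 - d\<^sup>2\<close> has one positive and two negative
  squares, so no pair in \<open>Delta\<close> consists of two vectors of positive square.\<close>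

lemma Delta_not_both_positive:
  assumes "(v1, v2) \<in> Delta"
  shows "\<not> (hprod v1 v1 = 1 \<and> hprod v2 v2 = 1)"
proof
  assume a: "hprod v1 v1 = 1 \<and> hprod v2 v2 = 1"
  define p q where "p = v1$1 - v1$2" and "q = v2$1 - v2$2"
  define c1 d1 c2 d2 where "c1 = v1$2" and "d1 = v1$3" and "c2 = v2$2" and "d2 = v2$3"
  note defs = p_def q_def c1_def d1_def c2_def d2_def
  have 1: "p\<^sup>2 = 1 + c1\<^sup>2 + d1\<^sup>2" and 2: "q\<^sup>2 = 1 + c2\<^sup>2 + d2\<^sup>2"
    using a by (auto simp: hprod_def defs power2_eq_square algebra_simps)
  have 3: "p * q = c1 * c2 + d1 * d2"
    using assms by (auto simp: Delta_def hprod_def defs algebra_simps)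
  have "(1 + c1\<^sup>2 + d1\<^sup>2) * (1 + c2\<^sup>2 + d2\<^sup>2) = (c1 * c2 + d1 * d2)\<^sup>2"
    unfolding 1[symmetric] 2[symmetric] 3[symmetric] by (simp add: power_mult_distrib)
  then have "1 + c1\<^sup>2 + d1\<^sup>2 + c2\<^sup>2 + d2\<^sup>2 + (c1 * d2 - c2 * d1)\<^sup>2 = 0"
    by (simp add: power2_eq_square algebra_simps)
  then show False
    by (smt (verit) zero_le_power2)
qed

definition framed_curve ::
    "real set \<Rightarrow> (real \<Rightarrow> hvec) \<Rightarrow> (real \<Rightarrow> hvec) \<Rightarrow> (real \<Rightarrow> hvec) \<Rightarrow> bool" where
  "framed_curve I \<gamma> \<nu>1 \<nu>2 \<longleftrightarrow>
     smooth_on I (\<lambda>t. (\<gamma> t, \<nu>1 t, \<nu>2 t)) \<and>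
     (\<forall>t\<in>I. (\<nu>1 t, \<nu>2 t) \<in> Delta \<and>
            hprod (deriv_on I \<gamma> t) (\<nu>1 t) = 0 \<and>
            hprod (deriv_on I \<gamma> t) (\<nu>2 t) = 0)"

definition curvature ::
    "real set \<Rightarrow> (real \<Rightarrow> hvec) \<Rightarrow> (real \<Rightarrow> hvec) \<Rightarrow> (real \<Rightarrow> hvec) \<Rightarrow>
     real \<Rightarrow> real \<times> real \<times> real \<times> real" where
  "curvature I \<gamma> \<nu>1 \<nu>2 t =
     (let \<mu> = hcross (\<nu>1 t) (\<nu>2 t);
          \<delta>1 = hprod (\<nu>1 t) (\<nu>1 t);
          \<delta>2 = hprod (\<nu>2 t) (\<nu>2 t)
      in (\<delta>2 * hprod (deriv_on I \<nu>1 t) (\<nu>2 t),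
          \<delta>1 * \<delta>2 * hprod (deriv_on I \<nu>1 t) \<mu>,
          \<delta>1 * \<delta>2 * hprod (deriv_on I \<nu>2 t) \<mu>,
          \<delta>1 * \<delta>2 * hprod (deriv_on I \<gamma> t) \<mu>))"

definition hybrid_motions :: "(real^3^3) set" where
  "hybrid_motions = {A. transpose A ** Gmat ** A = Gmat \<and> det A = 1}"

definition congruent_curves ::
    "real set \<Rightarrow> (real \<Rightarrow> hvec) \<Rightarrow> (real \<Rightarrow> hvec) \<Rightarrow> (real \<Rightarrow> hvec) \<Rightarrow>
     (real \<Rightarrow> hvec) \<Rightarrow> (real \<Rightarrow> hvec) \<Rightarrow> (real \<Rightarrow> hvec) \<Rightarrow> bool" where
  "congruent_curves I \<gamma> \<nu>1 \<nu>2 \<gamma>' \<nu>1' \<nu>2' \<longleftrightarrow>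
     (\<exists>A\<in>hybrid_motions. \<exists>H0. \<forall>t\<in>I.
        \<gamma>' t = A *v \<gamma> t + H0 \<and> \<nu>1' t = A *v \<nu>1 t \<and> \<nu>2' t = A *v \<nu>2 t)"

definition realizes ::
    "real set \<Rightarrow> (real \<Rightarrow> real \<times> real \<times> real \<times> real) \<Rightarrow> real \<Rightarrow> real \<Rightarrow>
     (real \<Rightarrow> hvec) \<Rightarrow> (real \<Rightarrow> hvec) \<Rightarrow> (real \<Rightarrow> hvec) \<Rightarrow> bool" where
  "realizes I \<kappa> \<delta>1 \<delta>2 \<gamma> \<nu>1 \<nu>2 \<longleftrightarrow>
     framed_curve I \<gamma> \<nu>1 \<nu>2 \<and>
     (\<forall>t\<in>I. curvature I \<gamma> \<nu>1 \<nu>2 t = \<kappa> t \<and>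
            hprod (\<nu>1 t) (\<nu>1 t) = \<delta>1 \<and> hprod (\<nu>2 t) (\<nu>2 t) = \<delta>2)"

end

theory Submission imports Defs begin

text \<open>
Write the frame \<open>(\<nu>1, \<nu>2, \<mu>)\<close> of a framed curve as the rows of a matrix \<open>X\<close>, and let \<open>D\<close> be the
diagonal matrix with entries \<open>\<delta>1\<close>, \<open>\<delta>2\<close>, \<open>\<delta>1 \<delta>2\<close>. The frame is orthonormal exactly if
\<open>X G X\<^sup>T = D\<close>, and a prescribed curvature \<open>(l, m, n, \<alpha>)\<close> amounts to the linear system \<open>X' = C X\<close>,
\<open>\<gamma>' = \<alpha> \<mu>\<close>, where the coefficient matrix \<open>C\<close> depends on \<open>l\<close>, \<open>m\<close>, \<open>n\<close> and satisfies
\<open>C\<^sup>T D + D C = 0\<close>. By this skewness, \<open>P\<^sup>T D Q\<close> is constant for any two solutions \<open>P\<close>, \<open>Q\<close> of the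
system (\<open>linear_ode_pairing_constant\<close>), and both halves of the theorem follow from this one law.

Existence: the linear system has a solution on all of \<open>I\<close> with any initial value
(\<open>linear_ode_solution_exists\<close>), and it is smooth since the coefficients are
(\<open>smooth_on_linear_ode_solution\<close>). Starting from an orthonormal frame, the law with \<open>P = Q\<close> keeps it
orthonormal, and continuity of the determinant keeps its orientation, so that \<open>\<mu>\<close> remains the vector
product of \<open>\<nu>1\<close> and \<open>\<nu>2\<close>. Integrating \<open>\<alpha> \<mu>\<close> gives the base curve. An orthonormal initial frame exists
unless \<open>\<delta>1 = \<delta>2 = 1\<close>.

Uniqueness: a framed curve with the given curvature satisfies the Frenet system
(\<open>framed_curve_frenet_equations\<close>). If \<open>R\<close> and \<open>S\<close> are the frames of two such curves, the matrix taking
the first to the second is \<open>S\<^sup>T D R G\<close>, which is constant by the law with \<open>P = S\<close>, \<open>Q = R\<close>. It is a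
hybrid motion because both frames have the same Gram matrix and the same determinant
(\<open>hybrid_motion_of_frames\<close>). After applying it, the base curves have the same derivative, hence differ
by a constant vector.
\<close>

section \<open>Linear differential equations on an arbitrary interval\<close>

text \<open>An interval may be open, closed or half-open at either end, so it need not be compact and continuous
functions on it need not be bounded. Antiderivatives and solutions of differential equations are
therefore studied near a point \<open>t\<close> on a compact subinterval that joins \<open>t\<close> to the base point \<open>t0\<close> and is a
neighbourhood of \<open>t\<close> relative to \<open>I\<close>; derivatives within the two sets then agree at \<open>t\<close>.\<close>

lemma interval_compact_localization:
  fixes I :: "real set"
  assumes "is_interval I" and "t0 \<in> I" and "t \<in> I"
  obtains a b where "{a..b} \<subseteq> I" and "t0 \<in> {a..b}" and "t \<in> {a..b}"
    and "at t within {a..b} = at t within I"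
proof -
  obtain a where a: "a \<in> I" "a \<le> t" "a \<le> t0" "a < t \<or> (\<forall>x\<in>I. a \<le> x)"
    by (metis assms(2,3) linorder_le_cases linorder_not_le order.trans)
  obtain b where b: "b \<in> I" "t \<le> b" "t0 \<le> b" "t < b \<or> (\<forall>x\<in>I. x \<le> b)"
    by (metis assms(2,3) linorder_le_cases linorder_not_le order.trans)
  have sub: "{a..b} \<subseteq> I"
    using mem_is_interval_1_I[OF assms(1) a(1) b(1)] by auto
  \<comment> \<open>Where the subinterval stops at \<open>t\<close>, so does \<open>I\<close>, and the neighbourhood may extend past \<open>t\<close>.\<close>
  define U where "U = {(if a < t then a else t - 1)<..<(if t < b then b else t + 1)}"
  have "x \<in> {a..b} \<longleftrightarrow> x \<in> I" if "x \<in> U" for x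
  proof
    assume "x \<in> I"
    have "a \<le> x"
      using a(4) \<open>x \<in> I\<close> \<open>x \<in> U\<close> by (cases "a < t") (simp_all add: U_def)
    moreover have "x \<le> b"
      using b(4) \<open>x \<in> I\<close> \<open>x \<in> U\<close> by (cases "t < b") (simp_all add: U_def)
    ultimately show "x \<in> {a..b}"
      by simp
  qed (use sub in blast)
  then have "{a..b} \<inter> U - {t} = I \<inter> U - {t}"
    by blast
  then have "at t within {a..b} = at t within I"
    by (rule at_within_nhd[rotated 2]) (simp_all add: U_def)
  then show thesis
    using that[of a b] sub a(2,3) b(2,3) by simp
qed

lemma antiderivative_on_interval:
  fixes f :: "real \<Rightarrow> 'a::banach"
  assumes "is_interval I" and "t0 \<in> I" and "continuous_on I f"
  shows "\<exists>F. F t0 = 0 \<and> (\<forall>t\<in>I. (F has_vector_derivative f t) (at t within I))"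
proof -
  define F where "F t = (if t0 \<le> t then integral {t0..t} f else - integral {t..t0} f)" for t
  have "F t0 = 0"
    by (simp add: F_def)
  moreover have "(F has_vector_derivative f t) (at t within I)" if "t \<in> I" for t
  proof -
    obtain a b where ab: "{a..b} \<subseteq> I" "t0 \<in> {a..b}" "t \<in> {a..b}"
        "at t within {a..b} = at t within I"
      using interval_compact_localization[OF assms(1,2) \<open>t \<in> I\<close>] .
    have cont: "continuous_on {a..b} f"
      using assms(3) ab(1) continuous_on_subset by blast
    have int: "f integrable_on {c..d}" if "a \<le> c" "d \<le> b" for c d
      using integrable_continuous_real[OF continuous_on_subset[OF cont]] that by auto
    have F_eq: "F x = integral {a..x} f - integral {a..t0} f" if "x \<in> {a..b}" for x
      using that ab(2) Henstock_Kurzweil_Integration.integral_combine[of a t0 x f]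
        Henstock_Kurzweil_Integration.integral_combine[of a x t0 f] int[of a x] int[of a t0]
      by (auto simp: F_def algebra_simps)
    have "((\<lambda>x. integral {a..x} f - integral {a..t0} f) has_vector_derivative f t - 0)
        (at t within {a..b})"
      using ab(3) cont
      by (intro has_vector_derivative_diff integral_has_vector_derivative
          has_vector_derivative_const)
    then have "(F has_vector_derivative f t) (at t within {a..b})"
      using has_vector_derivative_transform[OF ab(3) F_eq] by simp
    then show "(F has_vector_derivative f t) (at t within I)"
      by (simp add: ab(4))
  qed
  ultimately show ?thesis
    by blast
qed

text \<open>Integrating a bound on the derivative from \<open>t0\<close> gains one power and the factor
\<open>1 / (k + 1)\<close>, which is what makes the Picard series converge like the exponential series.
Running along the segment from \<open>t0\<close> to \<open>t\<close> with a parameter in \<open>[0, 1]\<close> treats both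
orders of \<open>t0\<close> and \<open>t\<close> at once.\<close>

lemma norm_le_of_derivative_power_bound:
  fixes F :: "real \<Rightarrow> 'a::real_normed_vector"
  assumes "convex S" and "t0 \<in> S" and "t \<in> S" and "F t0 = 0"
    and F': "\<And>s. s \<in> S \<Longrightarrow> (F has_vector_derivative F' s) (at s within S)"
    and bnd: "\<And>s. s \<in> S \<Longrightarrow> norm (F' s) \<le> c * \<bar>s - t0\<bar> ^ k"
  shows "norm (F t) \<le> c * \<bar>t - t0\<bar> ^ Suc k / real (Suc k)"
proof -
  define p where "p u = t0 + u * (t - t0)" for u
  have p_S: "p u \<in> S" if "u \<in> {0..1}" for u
    using that assms(1-3) convexD_alt[of S t0 t u] by (simp add: p_def algebra_simps)
  have p': "(p has_vector_derivative (t - t0)) (at u within A)" for u A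
    unfolding p_def by (auto intro!: derivative_eq_intros)
  have Fp': "(F \<circ> p has_vector_derivative (t - t0) *\<^sub>R F' (p u)) (at u within {0..1})"
    if "u \<in> {0..1}" for u
    using that p_S
    by (intro vector_diff_chain_within p' has_vector_derivative_within_subset[OF F']) auto
  have "norm ((F \<circ> p) 1 - (F \<circ> p) 0) \<le>
      c * \<bar>t - t0\<bar> ^ Suc k / real (Suc k) * 1 ^ Suc k - c * \<bar>t - t0\<bar> ^ Suc k / real (Suc k) * 0 ^ Suc k"
  proof (rule differentiable_bound_general[where f' = "\<lambda>u. (t - t0) *\<^sub>R F' (p u)" and a = 0 and b = 1
        and \<phi>' = "\<lambda>u. c * \<bar>t - t0\<bar> ^ Suc k * u ^ k"
        and \<phi> = "\<lambda>u. c * \<bar>t - t0\<bar> ^ Suc k / real (Suc k) * u ^ Suc k"])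
    show "continuous_on {0..1} (F \<circ> p)"
      using Fp' has_vector_derivative_continuous continuous_on_eq_continuous_within by blast
    fix u :: real assume u: "0 < u" "u < 1"
    show "(F \<circ> p has_vector_derivative (t - t0) *\<^sub>R F' (p u)) (at u)"
      using Fp'[of u] u by (simp add: at_within_Icc_at)
    have "((\<lambda>u. c * \<bar>t - t0\<bar> ^ Suc k / real (Suc k) * u ^ Suc k) has_real_derivative
        c * \<bar>t - t0\<bar> ^ Suc k / real (Suc k) * (real (Suc k) * u ^ k)) (at u)"
      using DERIV_cmult[OF DERIV_pow[of "Suc k" u UNIV],
          of "c * \<bar>t - t0\<bar> ^ Suc k / real (Suc k)"] by simp
    then show "((\<lambda>u. c * \<bar>t - t0\<bar> ^ Suc k / real (Suc k) * u ^ Suc k) has_vector_derivative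
        c * \<bar>t - t0\<bar> ^ Suc k * u ^ k) (at u)"
      by (simp add: has_real_derivative_iff_has_vector_derivative mult.assoc del: of_nat_Suc)
    have "norm ((t - t0) *\<^sub>R F' (p u)) \<le> \<bar>t - t0\<bar> * (c * \<bar>p u - t0\<bar> ^ k)"
      using bnd[OF p_S] u by (simp add: mult_left_mono)
    also have "\<bar>p u - t0\<bar> = u * \<bar>t - t0\<bar>"
      using u by (simp add: p_def abs_mult)
    finally show "norm ((t - t0) *\<^sub>R F' (p u)) \<le> c * \<bar>t - t0\<bar> ^ Suc k * u ^ k"
      by (simp add: power_mult_distrib algebra_simps)
  qed (auto intro!: continuous_intros)
  then show ?thesis
    by (simp add: p_def assms(4))
qed

text \<open>The solution is the Picard series \<open>X = Z 0 + Z 1 + \<dots>\<close>, where \<open>Z 0 = x0\<close> and \<open>Z (k + 1)\<close> is the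
antiderivative of \<open>C \<cdot> Z k\<close> that vanishes at \<open>t0\<close>. The terms are defined on all of \<open>I\<close> at
once, so no local solutions have to be glued. On a compact subinterval containing \<open>t0\<close> the coefficient
is bounded, say with constant \<open>M\<close>, and the \<open>k\<close>-th term is at most
\<open>\<parallel>x0\<parallel> (M \<bar>t - t0\<bar>)\<^sup>k / k!\<close>. Hence the series and its derivative
converge uniformly there, and termwise differentiation gives the equation.\<close>

theorem linear_ode_solution_exists:
  fixes prod :: "'b::real_normed_vector \<Rightarrow> 'a::banach \<Rightarrow> 'a"
  assumes "bounded_bilinear prod" and I: "is_interval I" and t0: "t0 \<in> I"
    and C: "continuous_on I C"
  shows "\<exists>X. X t0 = x0 \<and> (\<forall>t\<in>I. (X has_vector_derivative prod (C t) (X t)) (at t within I))"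
proof -
  interpret prod: bounded_bilinear prod by fact
  define step where "step Z = (SOME F. F t0 = 0 \<and>
      (\<forall>t\<in>I. (F has_vector_derivative prod (C t) (Z t)) (at t within I)))" for Z
  have step: "step Z t0 = 0 \<and>
      (\<forall>t\<in>I. (step Z has_vector_derivative prod (C t) (Z t)) (at t within I))"
    if "continuous_on I Z" for Z
    unfolding step_def
    by (rule someI_ex[OF antiderivative_on_interval[OF I t0 prod.continuous_on[OF C that]]])
  define Z where "Z k = (step ^^ k) (\<lambda>_. x0)" for k
  have Z0: "Z 0 = (\<lambda>_. x0)" and ZSuc: "Z (Suc k) = step (Z k)" for k
    by (simp_all add: Z_def)
  have Z_cont: "continuous_on I (Z k)" for k
  proof (induction k)
    case (Suc k)
    then show ?case
      unfolding ZSuc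
      by (auto simp: continuous_on_eq_continuous_within
          intro: has_vector_derivative_continuous[OF step[THEN conjunct2, rule_format]])
  qed (simp add: Z0)
  \<comment> \<open>The derivative of \<open>Z k\<close>, which for \<open>k > 0\<close> involves the preceding term.\<close>
  define Z' where "Z' k t = (case k of 0 \<Rightarrow> 0 | Suc j \<Rightarrow> prod (C t) (Z j t))" for k t
  have Z_deriv: "(Z k has_vector_derivative Z' k t) (at t within I)" if "t \<in> I" for k t
    using step[OF Z_cont] that by (cases k) (auto simp: Z0 ZSuc Z'_def)
  have Z_t0: "Z k t0 = (if k = 0 then x0 else 0)" for k
    using step[OF Z_cont] by (cases k) (auto simp: Z0 ZSuc)
  define X where "X t = (\<Sum>k. Z k t)" for t
  have "(X has_vector_derivative prod (C t) (X t)) (at t within I)" if t: "t \<in> I" for t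
  proof -
    obtain a b where ab: "{a..b} \<subseteq> I" "t0 \<in> {a..b}" "t \<in> {a..b}"
        "at t within {a..b} = at t within I"
      using interval_compact_localization[OF I t0 t] .
    have Z_deriv_ab: "(Z k has_vector_derivative Z' k s) (at s within {a..b})"
      if "s \<in> {a..b}" for k s
      using has_vector_derivative_within_subset[OF Z_deriv ab(1)] ab(1) that by blast
    obtain K where K: "K > 0" "\<And>x y. norm (prod x y) \<le> norm x * norm y * K"
      using prod.pos_bounded by blast
    have "bounded (C ` {a..b})"
      using C ab(1) by (intro compact_imp_bounded compact_continuous_image)
        (auto intro: continuous_on_subset)
    then obtain N where N: "N > 0" "\<And>s. s \<in> {a..b} \<Longrightarrow> norm (C s) \<le> N"
      unfolding bounded_pos by auto
    define M where "M = N * K"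
    have M: "M > 0" and prod_le: "norm (prod (C s) y) \<le> M * norm y" if "s \<in> {a..b}" for s y
    proof -
      show "M > 0" using N K by (simp add: M_def)
      have "norm (C s) * norm y * K \<le> N * norm y * K"
        using N(2)[OF that] K by (intro mult_right_mono) auto
      then show "norm (prod (C s) y) \<le> M * norm y"
        using K(2)[of "C s" y] by (simp add: M_def algebra_simps)
    qed
    have Z_le: "norm (Z k s) \<le> norm x0 * (M ^ k * \<bar>s - t0\<bar> ^ k / fact k)" if "s \<in> {a..b}" for k s
      using that
    proof (induction k arbitrary: s)
      case (Suc k)
      have "norm (Z (Suc k) s) \<le>
          (norm x0 * M ^ Suc k / fact k) * \<bar>s - t0\<bar> ^ Suc k / real (Suc k)"
      proof (rule norm_le_of_derivative_power_bound[where F' = "\<lambda>s. prod (C s) (Z k s)"])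
        fix r assume r: "r \<in> {a..b}"
        show "(Z (Suc k) has_vector_derivative prod (C r) (Z k r)) (at r within {a..b})"
          using Z_deriv_ab[OF r, of "Suc k"] by (simp add: Z'_def)
        have "norm (prod (C r) (Z k r)) \<le> M * norm (Z k r)"
          using prod_le[OF r] .
        also have "\<dots> \<le> M * (norm x0 * (M ^ k * \<bar>r - t0\<bar> ^ k / fact k))"
          using Suc.IH[OF r] M[OF r] by (intro mult_left_mono) auto
        finally show "norm (prod (C r) (Z k r)) \<le> norm x0 * M ^ Suc k / fact k * \<bar>r - t0\<bar> ^ k"
          by (simp add: algebra_simps)
      qed (use Suc.prems ab Z_t0 in auto)
      then show ?case
        by (simp add: field_simps)
    qed (simp add: Z0)
    define B where "B k = norm x0 * (M ^ k * (b - a) ^ k / fact k)" for k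
    have Z_B: "norm (Z k s) \<le> B k" if "s \<in> {a..b}" for k s
    proof -
      have "\<bar>s - t0\<bar> ^ k \<le> (b - a) ^ k"
        using that ab(2) by (intro power_mono) auto
      then have "norm x0 * (M ^ k * \<bar>s - t0\<bar> ^ k / fact k) \<le> B k"
        unfolding B_def using M[OF that]
        by (intro mult_left_mono divide_right_mono) auto
      then show ?thesis
        using Z_le[OF that, of k] by linarith
    qed
    have B_summable: "summable B"
      unfolding B_def using summable_exp[of "M * (b - a)"]
      by (intro summable_mult) (simp add: power_mult_distrib divide_inverse mult_ac)
    have sums: "(\<lambda>k. Z k s) sums X s" if "s \<in> {a..b}" for s
      unfolding X_def using Z_B that
      by (intro summable_sums summable_comparison_test'[OF B_summable, of 0]) auto
    have sums': "(\<lambda>k. Z' k s) sums prod (C s) (X s)" if "s \<in> {a..b}" for s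
    proof -
      have "(\<lambda>k. Z' (Suc k) s) sums prod (C s) (X s)"
        unfolding Z'_def using prod.bounded_linear_right[THEN bounded_linear.sums] sums[OF that]
        by auto
      then show ?thesis
        by (subst (asm) sums_Suc_iff) (simp add: Z'_def)
    qed
    have unif: "uniform_limit {a..b} (\<lambda>n s. \<Sum>k<n. Z' k s) (\<lambda>s. \<Sum>k. Z' k s) sequentially"
    proof (rule Weierstrass_m_test[where M = "\<lambda>k. case k of 0 \<Rightarrow> 0 | Suc j \<Rightarrow> M * B j"])
      fix k s assume s: "s \<in> {a..b}"
      have "norm (prod (C s) (Z j s)) \<le> M * B j" for j
        using prod_le[OF s, of "Z j s"] mult_left_mono[OF Z_B[OF s, of j], of M] M[OF s] by linarith
      then show "norm (Z' k s) \<le> (case k of 0 \<Rightarrow> 0 | Suc j \<Rightarrow> M * B j)"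
        by (auto simp: Z'_def split: nat.split)
      next
      show "summable (\<lambda>k. case k of 0 \<Rightarrow> 0 | Suc j \<Rightarrow> M * B j)"
        using B_summable by (subst summable_Suc_iff[symmetric]) (simp add: summable_mult)
    qed
    have "\<exists>g. \<forall>s\<in>{a..b}. (\<lambda>k. Z k s) sums g s \<and>
        (g has_derivative (\<lambda>h. h *\<^sub>R prod (C s) (X s))) (at s within {a..b})"
    proof (rule has_derivative_series[where f' = "\<lambda>k s h. h *\<^sub>R Z' k s" and x = t and l = "X t"])
      show "(Z k has_derivative (\<lambda>h. h *\<^sub>R Z' k s)) (at s within {a..b})" if "s \<in> {a..b}" for k s
        using Z_deriv_ab[OF that] by (simp add: has_vector_derivative_def)
      fix e :: real assume "e > 0"
      then have "\<forall>\<^sub>F n in sequentially. \<forall>s\<in>{a..b}. dist (\<Sum>k<n. Z' k s) (\<Sum>k. Z' k s) < e"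
        using unif by (rule uniform_limitD[rotated])
      then show "\<forall>\<^sub>F n in sequentially. \<forall>s\<in>{a..b}. \<forall>h.
          norm ((\<Sum>k<n. h *\<^sub>R Z' k s) - h *\<^sub>R prod (C s) (X s)) \<le> e * norm h"
      proof (rule eventually_mono, intro ballI allI)
        fix n s h
        assume *: "\<forall>s\<in>{a..b}. dist (\<Sum>k<n. Z' k s) (\<Sum>k. Z' k s) < e" and s: "s \<in> {a..b}"
        have "norm ((\<Sum>k<n. Z' k s) - prod (C s) (X s)) \<le> e"
          using * s sums_unique[OF sums'[OF s]] by (auto simp: dist_norm intro: less_imp_le)
        then have "\<bar>h\<bar> * norm ((\<Sum>k<n. Z' k s) - prod (C s) (X s)) \<le> \<bar>h\<bar> * e"
          by (intro mult_left_mono) auto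
        then show "norm ((\<Sum>k<n. h *\<^sub>R Z' k s) - h *\<^sub>R prod (C s) (X s)) \<le> e * norm h"
          by (simp add: scaleR_sum_right[symmetric] scaleR_diff_right[symmetric] mult.commute
              del: scaleR_diff_right)
      qed
    next
      show "t \<in> {a..b}" "(\<lambda>k. Z k t) sums X t"
        using ab(3) sums by auto
    qed simp
    then obtain g where g: "\<And>s. s \<in> {a..b} \<Longrightarrow> (\<lambda>k. Z k s) sums g s"
      "\<And>s. s \<in> {a..b} \<Longrightarrow>
        (g has_vector_derivative prod (C s) (X s)) (at s within {a..b})"
      unfolding has_vector_derivative_def by blast
    have "X s = g s" if "s \<in> {a..b}" for s
      using sums[OF that] g(1)[OF that] sums_unique2 by blast
    then have "(X has_vector_derivative prod (C t) (X t)) (at t within {a..b})"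
      using has_vector_derivative_transform[OF ab(3) _ g(2)[OF ab(3)]] by blast
    then show ?thesis
      by (simp add: ab(4))
  qed
  moreover have "X t0 = x0"
    unfolding X_def Z_t0 using sums_unique[OF sums_single[of 0 "\<lambda>_. x0"]] by simp
  ultimately show ?thesis
    by blast
qed

section \<open>Smooth functions on an interval\<close>

text \<open>Smoothness is a statement about all iterated derivatives, while closure properties such as the product
rule are proved by induction on the number of derivatives and need this finite-order version.\<close>

definition times_differentiable_on ::
    "nat \<Rightarrow> real set \<Rightarrow> (real \<Rightarrow> 'a::real_normed_vector) \<Rightarrow> bool" where
  "times_differentiable_on k I f \<longleftrightarrow> (\<forall>j<k. (deriv_on I ^^ j) f differentiable_on I)"

lemma smooth_on_iff_times_differentiable_on:
  "smooth_on I f \<longleftrightarrow> (\<forall>k. times_differentiable_on k I f)"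
  unfolding smooth_on_def times_differentiable_on_def by blast

lemma times_differentiable_on_0: "times_differentiable_on 0 I f"
  by (simp add: times_differentiable_on_def)

lemma times_differentiable_on_Suc:
  "times_differentiable_on (Suc k) I f \<longleftrightarrow>
     f differentiable_on I \<and> times_differentiable_on k I (deriv_on I f)"
  unfolding times_differentiable_on_def All_less_Suc2
  by (simp add: funpow_swap1)

lemma times_differentiable_on_SucD:
  "times_differentiable_on (Suc k) I f \<Longrightarrow> times_differentiable_on k I f"
  by (simp add: times_differentiable_on_def)

lemma deriv_on_works:
  assumes "f differentiable_on I" and "t \<in> I"
  shows "(f has_vector_derivative deriv_on I f t) (at t within I)"
  using assms vector_derivative_works unfolding deriv_on_def differentiable_on_def by blast

lemma smooth_on_imp_differentiable_on: "smooth_on I f \<Longrightarrow> f differentiable_on I"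
  unfolding smooth_on_def by (metis funpow_0)

lemma smooth_on_imp_continuous_on: "smooth_on I f \<Longrightarrow> continuous_on I f"
  by (simp add: differentiable_imp_continuous_on smooth_on_imp_differentiable_on)

lemma deriv_on_cong:
  assumes "\<And>t. t \<in> I \<Longrightarrow> f t = g t" and "t \<in> I"
  shows "deriv_on I f t = deriv_on I g t"
  unfolding deriv_on_def using assms by (intro vector_derivative_cong_eq) auto

lemma differentiable_on_cong:
  assumes "\<And>t. t \<in> I \<Longrightarrow> f t = g t" and "f differentiable_on I"
  shows "g differentiable_on I"
  using assms(2) has_derivative_transform[of _ I g f] assms(1)
  unfolding differentiable_on_def differentiable_def by metis

lemma times_differentiable_on_cong:
  assumes "\<And>t. t \<in> I \<Longrightarrow> f t = g t"
  shows "times_differentiable_on k I f \<longleftrightarrow> times_differentiable_on k I g"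
  using assms
proof (induction k arbitrary: f g)
  case (Suc k)
  have "f differentiable_on I \<longleftrightarrow> g differentiable_on I"
    using Suc.prems differentiable_on_cong[of I f g] differentiable_on_cong[of I g f] by auto
  then show ?case
    using Suc.IH[of "deriv_on I f" "deriv_on I g"] deriv_on_cong[of I f g] Suc.prems
    by (simp add: times_differentiable_on_Suc)
qed (simp add: times_differentiable_on_0)

text \<open>No point of \<open>I\<close> is isolated in \<open>I\<close>; this is what makes derivatives within \<open>I\<close> unique.\<close>

definition perfect_on :: "real set \<Rightarrow> bool" where
  "perfect_on I \<longleftrightarrow> (\<forall>t\<in>I. at t within I \<noteq> bot)"

lemma perfect_on_interval:
  assumes "is_interval I" and "interior I \<noteq> {}"
  shows "perfect_on I"
proof -
  have "I \<noteq> {x}" for x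
    using assms(2) interior_singleton by metis
  then have "t islimpt I" if "t \<in> I" for t
    using connected_imp_perfect[OF is_interval_connected[OF assms(1)] that] by blast
  then show ?thesis
    by (simp add: perfect_on_def trivial_limit_within)
qed

lemma deriv_on_eq:
  assumes "perfect_on I" and "t \<in> I" and "(f has_vector_derivative f') (at t within I)"
  shows "deriv_on I f t = f'"
  unfolding deriv_on_def using assms vector_derivative_within unfolding perfect_on_def by blast

lemma times_differentiable_on_Suc_if_derivative:
  assumes "perfect_on I"
    and f': "\<And>t. t \<in> I \<Longrightarrow> (f has_vector_derivative f' t) (at t within I)"
    and "times_differentiable_on k I f'"
  shows "times_differentiable_on (Suc k) I f"
  unfolding times_differentiable_on_Suc
proof
  show "f differentiable_on I"
    using f' differentiableI_vector unfolding differentiable_on_def by blast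
  have "deriv_on I f t = f' t" if "t \<in> I" for t
    using deriv_on_eq[OF assms(1) that f'[OF that]] .
  then show "times_differentiable_on k I (deriv_on I f)"
    using times_differentiable_on_cong[of I "deriv_on I f" f'] assms(3) by blast
qed

lemma times_differentiable_on_linear:
  assumes "perfect_on I" and "bounded_linear h" and "times_differentiable_on k I f"
  shows "times_differentiable_on k I (\<lambda>t. h (f t))"
  using assms(3)
proof (induction k arbitrary: f)
  case (Suc k)
  show ?case
  proof (rule times_differentiable_on_Suc_if_derivative[OF assms(1)])
    show "((\<lambda>t. h (f t)) has_vector_derivative h (deriv_on I f t)) (at t within I)"
      if "t \<in> I" for t
      using Suc.prems that
      by (intro bounded_linear.has_vector_derivative[OF assms(2)] deriv_on_works)
        (auto simp: times_differentiable_on_Suc)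
  qed (use Suc in \<open>auto simp: times_differentiable_on_Suc\<close>)
qed (simp add: times_differentiable_on_0)

lemma times_differentiable_on_add:
  assumes "perfect_on I" and "times_differentiable_on k I f" and "times_differentiable_on k I g"
  shows "times_differentiable_on k I (\<lambda>t. f t + g t)"
  using assms(2,3)
proof (induction k arbitrary: f g)
  case (Suc k)
  show ?case
  proof (rule times_differentiable_on_Suc_if_derivative[OF assms(1)])
    show "((\<lambda>t. f t + g t) has_vector_derivative deriv_on I f t + deriv_on I g t) (at t within I)"
      if "t \<in> I" for t
      using Suc.prems that
      by (intro has_vector_derivative_add deriv_on_works) (auto simp: times_differentiable_on_Suc)
  qed (use Suc in \<open>auto simp: times_differentiable_on_Suc\<close>)
qed (simp add: times_differentiable_on_0)

lemma times_differentiable_on_bilinear: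
  assumes "perfect_on I" and "bounded_bilinear h"
    and "times_differentiable_on k I f" and "times_differentiable_on k I g"
  shows "times_differentiable_on k I (\<lambda>t. h (f t) (g t))"
  using assms(3,4)
proof (induction k arbitrary: f g)
  case (Suc k)
  show ?case
  proof (rule times_differentiable_on_Suc_if_derivative[OF assms(1)])
    show "((\<lambda>t. h (f t) (g t)) has_vector_derivative
        h (f t) (deriv_on I g t) + h (deriv_on I f t) (g t)) (at t within I)"
      if "t \<in> I" for t
      using Suc.prems that
      by (intro bounded_bilinear.has_vector_derivative[OF assms(2)] deriv_on_works)
        (auto simp: times_differentiable_on_Suc)
    show "times_differentiable_on k I
        (\<lambda>t. h (f t) (deriv_on I g t) + h (deriv_on I f t) (g t))"
      using Suc.prems Suc.prems[THEN times_differentiable_on_SucD]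
      by (intro times_differentiable_on_add[OF assms(1)] Suc.IH)
        (auto simp: times_differentiable_on_Suc)
  qed
qed (simp add: times_differentiable_on_0)

lemma smooth_on_linear:
  assumes "perfect_on I" and "bounded_linear h" and "smooth_on I f"
  shows "smooth_on I (\<lambda>t. h (f t))"
  using assms times_differentiable_on_linear
  unfolding smooth_on_iff_times_differentiable_on by blast

lemma smooth_on_add:
  assumes "perfect_on I" and "smooth_on I f" and "smooth_on I g"
  shows "smooth_on I (\<lambda>t. f t + g t)"
  using assms times_differentiable_on_add
  unfolding smooth_on_iff_times_differentiable_on by blast

lemma smooth_on_bilinear:
  assumes "perfect_on I" and "bounded_bilinear h" and "smooth_on I f" and "smooth_on I g"
  shows "smooth_on I (\<lambda>t. h (f t) (g t))"
  using assms times_differentiable_on_bilinear[of I h]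
  unfolding smooth_on_iff_times_differentiable_on by blast

lemma smooth_on_Pair:
  assumes "perfect_on I" and "smooth_on I f" and "smooth_on I g"
  shows "smooth_on I (\<lambda>t. (f t, g t))"
proof -
  have "smooth_on I (\<lambda>t. (f t, 0) + (0, g t))"
    using assms
    by (intro smooth_on_add smooth_on_linear[where h = "\<lambda>x. (x, 0)"]
        smooth_on_linear[where h = "\<lambda>y. (0, y)"] bounded_linear_Pair
        bounded_linear_ident bounded_linear_zero)
  then show ?thesis
    by simp
qed

lemma smooth_on_if_derivative_smooth:
  assumes "perfect_on I" and "smooth_on I f'"
    and "\<And>t. t \<in> I \<Longrightarrow> (f has_vector_derivative f' t) (at t within I)"
  shows "smooth_on I f"
  unfolding smooth_on_iff_times_differentiable_on
proof
  fix k
  have "times_differentiable_on (Suc k) I f"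
    using times_differentiable_on_Suc_if_derivative[OF assms(1,3)] assms(2)
    unfolding smooth_on_iff_times_differentiable_on by blast
  then show "times_differentiable_on k I f"
    by (rule times_differentiable_on_SucD)
qed

text \<open>Bootstrapping: if \<open>X\<close> is \<open>k\<close> times differentiable then so is \<open>X' = C \<cdot> X\<close>, hence \<open>X\<close> is
\<open>k + 1\<close> times differentiable.\<close>

lemma smooth_on_linear_ode_solution:
  assumes "perfect_on I" and "bounded_bilinear h" and "smooth_on I C"
    and X': "\<And>t. t \<in> I \<Longrightarrow> (X has_vector_derivative h (C t) (X t)) (at t within I)"
  shows "smooth_on I X"
  unfolding smooth_on_iff_times_differentiable_on
proof
  fix k
  show "times_differentiable_on k I X"
  proof (induction k)
    case (Suc k)
    then have "times_differentiable_on k I (\<lambda>t. h (C t) (X t))"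
      using times_differentiable_on_bilinear[OF assms(1,2)] assms(3)
      unfolding smooth_on_iff_times_differentiable_on by blast
    then show ?case
      using times_differentiable_on_Suc_if_derivative[OF assms(1), of X "\<lambda>t. h (C t) (X t)"] X'
      by blast
  qed (rule times_differentiable_on_0)
qed

section \<open>Linear systems that preserve a bilinear form\<close>

lemma bounded_bilinear_matrix_mult:
  "bounded_bilinear ((**) :: real^'n^'m \<Rightarrow> real^'k^'n \<Rightarrow> real^'k^'m)"
  unfolding bilinear_conv_bounded_bilinear[symmetric] bilinear_def linear_iff
  by (simp add: vec_eq_iff matrix_matrix_mult_def sum.distrib sum_distrib_left algebra_simps)

lemma bounded_linear_transpose: "bounded_linear (transpose :: real^'n^'m \<Rightarrow> real^'m^'n)"
  unfolding linear_conv_bounded_linear[symmetric] linear_iff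
  by (simp add: vec_eq_iff transpose_def)

lemma has_vector_derivative_rows:
  fixes F :: "real \<Rightarrow> 'a::euclidean_space^'n"
  assumes "\<And>i. ((\<lambda>t. F t $ i) has_vector_derivative F' $ i) (at t within S)"
  shows "(F has_vector_derivative F') (at t within S)"
proof -
  have "((\<lambda>t. F t $ i \<bullet> u) has_vector_derivative F' $ i \<bullet> u) (at t within S)" for i u
    by (intro bounded_linear.has_vector_derivative[OF bounded_linear_inner_left] assms)
  then show ?thesis
    unfolding has_vector_derivative_def
    by (subst has_derivative_componentwise_within)
      (auto simp: Basis_vec_def inner_axis has_vector_derivative_def)
qed

text \<open>The conservation law behind both halves of the theorem. The derivative of \<open>P\<^sup>T D Q\<close> is
\<open>P\<^sup>T (C\<^sup>T D + D C) Q\<close>, which vanishes when \<open>C\<close> is skew with respect to \<open>D\<close>. With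
\<open>P = Q\<close> it keeps a frame orthonormal; with two different frames it shows that the motion carrying
one to the other does not depend on the parameter.\<close>

lemma linear_ode_pairing_constant:
  fixes P Q C :: "real \<Rightarrow> real^'n^'n" and D :: "real^'n^'n"
  assumes "convex I"
    and P': "\<And>t. t \<in> I \<Longrightarrow> (P has_vector_derivative C t ** P t) (at t within I)"
    and Q': "\<And>t. t \<in> I \<Longrightarrow> (Q has_vector_derivative C t ** Q t) (at t within I)"
    and skew: "\<And>t. t \<in> I \<Longrightarrow> transpose (C t) ** D + D ** C t = 0"
    and "s \<in> I" and "t \<in> I"
  shows "transpose (P s) ** D ** Q s = transpose (P t) ** D ** Q t"
proof -
  have "((\<lambda>t. transpose (P t) ** (D ** Q t)) has_vector_derivative 0) (at t within I)"
    if t: "t \<in> I" for t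
  proof -
    have "((\<lambda>t. transpose (P t) ** (D ** Q t)) has_vector_derivative
        transpose (P t) ** (D ** (C t ** Q t)) + transpose (C t ** P t) ** (D ** Q t))
        (at t within I)"
      using bounded_bilinear.bounded_linear_right[OF bounded_bilinear_matrix_mult]
      by (intro bounded_bilinear.has_vector_derivative[OF bounded_bilinear_matrix_mult]
          bounded_linear.has_vector_derivative[OF bounded_linear_transpose]
          bounded_linear.has_vector_derivative[where f = "(**) D"] P' Q' t)
    also have "transpose (P t) ** (D ** (C t ** Q t)) + transpose (C t ** P t) ** (D ** Q t) =
        transpose (P t) ** ((transpose (C t) ** D + D ** C t) ** Q t)"
      by (simp add: matrix_transpose_mul matrix_mul_assoc matrix_add_ldistrib
          bounded_bilinear.add_left[OF bounded_bilinear_matrix_mult])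
    also have "\<dots> = 0"
      unfolding skew[OF t]
      by (simp add: bounded_bilinear.zero_left[OF bounded_bilinear_matrix_mult]
          bounded_bilinear.zero_right[OF bounded_bilinear_matrix_mult])
    finally show ?thesis .
  qed
  then obtain c where "\<And>t. t \<in> I \<Longrightarrow> transpose (P t) ** (D ** Q t) = c"
    using has_vector_derivative_zero_constant[OF assms(1)] by blast
  then show ?thesis
    using assms(5,6) by (simp add: matrix_mul_assoc[symmetric])
qed

text \<open>The conserved quantity is built from \<open>X\<^sup>T D X\<close>, whereas orthonormality of the rows of \<open>X\<close> is the
condition \<open>X G X\<^sup>T = D\<close>. They are related because a one-sided inverse of a square matrix is two-sided.\<close>

lemma gram_eq_iff_left_inverse:
  fixes X G D :: "real^'n^'n"
  assumes "D ** D = mat 1"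
  shows "X ** G ** transpose X = D \<longleftrightarrow> (transpose X ** D) ** (X ** G) = mat 1"
proof -
  have "X ** G ** transpose X = D \<longleftrightarrow> (X ** G) ** (transpose X ** D) = mat 1"
    by (metis assms matrix_mul_assoc matrix_mul_rid)
  then show ?thesis
    using matrix_left_right_inverse by blast
qed

section \<open>Orthonormal frames of hybrid vectors\<close>

lemma bounded_bilinear_hprod: "bounded_bilinear hprod"
  unfolding bilinear_conv_bounded_bilinear[symmetric] bilinear_def linear_iff
  by (simp add: hprod_def algebra_simps)

lemma bounded_bilinear_hcross: "bounded_bilinear hcross"
  unfolding bilinear_conv_bounded_bilinear[symmetric] bilinear_def linear_iff
  by (simp add: hcross_def vec_eq_iff forall_3 algebra_simps)

lemma hprod_commute: "hprod x y = hprod y x"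
  by (simp add: hprod_def algebra_simps)

lemma gram_entry: "(P ** Gmat ** transpose Q) $ i $ j = hprod (P $ i) (Q $ j)"
  by (simp add: matrix_matrix_mult_def transpose_def Gmat_def sum_3 hprod_def algebra_simps)

lemma hprod_matrix_vector: "((P ** Gmat) *v u) $ i = hprod (P $ i) u"
  by (simp add: matrix_matrix_mult_def matrix_vector_mult_def Gmat_def sum_3 hprod_def algebra_simps)

lemma hprod_hcross: "hprod (hcross x y) z = - det (vector [x, y, z] :: real^3^3)"
  by (simp add: hprod_def hcross_def det_3 algebra_simps)

lemma hprod_hcross_self:
  "hprod (hcross x y) (hcross x y) = hprod x x * hprod y y - (hprod x y)\<^sup>2"
  by (simp add: hprod_def hcross_def power2_eq_square algebra_simps)

lemma hprod_hcross_orthogonal: "hprod x (hcross x y) = 0" "hprod y (hcross x y) = 0"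
  by (simp_all add: hprod_def hcross_def algebra_simps)

text \<open>The moving frame \<open>(\<nu>1, \<nu>2, \<mu>)\<close> is stored in the rows of a matrix, so that the Frenet
equations read \<open>X' = C X\<close> and the scalar products of its vectors are the entries of \<open>X G X\<^sup>T\<close>.\<close>

definition frame :: "hvec \<Rightarrow> hvec \<Rightarrow> real^3^3" where
  "frame x y = vector [x, y, hcross x y]"

definition signature_matrix :: "real \<Rightarrow> real \<Rightarrow> real^3^3" where
  "signature_matrix \<delta>1 \<delta>2 =
     vector [vector [\<delta>1, 0, 0], vector [0, \<delta>2, 0], vector [0, 0, \<delta>1 * \<delta>2]]"

definition frenet_matrix :: "real \<Rightarrow> real \<Rightarrow> real \<Rightarrow> real \<Rightarrow> real \<Rightarrow> real^3^3" where
  "frenet_matrix \<delta>1 \<delta>2 l m n =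
     vector [vector [0, l, m], vector [- \<delta>1 * \<delta>2 * l, 0, n], vector [- \<delta>2 * m, - \<delta>1 * n, 0]]"

lemma frame_rows [simp]:
  "frame x y $ 1 = x" "frame x y $ 2 = y" "frame x y $ 3 = hcross x y"
  by (simp_all add: frame_def)

lemma signature_matrix_involution:
  assumes "\<delta>1 \<in> {1, -1}" and "\<delta>2 \<in> {1, -1}"
  shows "signature_matrix \<delta>1 \<delta>2 ** signature_matrix \<delta>1 \<delta>2 = mat 1"
  using assms
  by (auto simp: signature_matrix_def vec_eq_iff forall_3 matrix_matrix_mult_def sum_3 mat_def)

lemma frenet_matrix_skew:
  assumes "\<delta>1 \<in> {1, -1}" and "\<delta>2 \<in> {1, -1}"
  shows "transpose (frenet_matrix \<delta>1 \<delta>2 l m n) ** signature_matrix \<delta>1 \<delta>2 +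
    signature_matrix \<delta>1 \<delta>2 ** frenet_matrix \<delta>1 \<delta>2 l m n = 0"
  using assms
  by (auto simp: signature_matrix_def frenet_matrix_def vec_eq_iff forall_3
      matrix_matrix_mult_def transpose_def sum_3)

lemma frenet_matrix_times_signature:
  assumes "\<delta>1 \<in> {1, -1}" and "\<delta>2 \<in> {1, -1}"
  shows "frenet_matrix \<delta>1 \<delta>2 l m n ** signature_matrix \<delta>1 \<delta>2 =
    vector [vector [0, \<delta>2 * l, \<delta>1 * \<delta>2 * m], vector [- (\<delta>2 * l), 0, \<delta>1 * \<delta>2 * n],
      vector [- (\<delta>1 * \<delta>2 * m), - (\<delta>1 * \<delta>2 * n), 0]]"
  using assms
  by (auto simp: signature_matrix_def frenet_matrix_def vec_eq_iff forall_3
      matrix_matrix_mult_def sum_3)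

lemma gram_frame:
  assumes "hprod x x = \<delta>1" and "hprod y y = \<delta>2" and "hprod x y = 0"
  shows "frame x y ** Gmat ** transpose (frame x y) = signature_matrix \<delta>1 \<delta>2"
proof -
  have "hprod y x = 0" "hprod (hcross x y) x = 0" "hprod (hcross x y) y = 0"
    using assms(3) hprod_hcross_orthogonal by (simp_all add: hprod_commute)
  then show ?thesis
    using assms hprod_hcross_orthogonal[where x = x and y = y]
    by (simp add: vec_eq_iff forall_3 gram_entry hprod_hcross_self signature_matrix_def)
qed

lemma det_frame:
  assumes "hprod x x = \<delta>1" and "hprod y y = \<delta>2" and "hprod x y = 0"
  shows "det (frame x y) = - (\<delta>1 * \<delta>2)"
  using assms hprod_hcross[of x y "hcross x y"] by (simp add: frame_def hprod_hcross_self)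

text \<open>A vector is determined by its scalar products with an orthonormal frame. This replaces every expansion
of a vector in the frame.\<close>

lemma eq_if_hprod_rows_eq:
  fixes X D :: "real^3^3"
  assumes "X ** Gmat ** transpose X = D" and "D ** D = mat 1"
    and "\<And>i. hprod (X $ i) u = hprod (X $ i) w"
  shows "u = w"
proof -
  have "(X ** Gmat) *v u = (X ** Gmat) *v w"
    using assms(3) by (simp add: vec_eq_iff hprod_matrix_vector)
  then have "((transpose X ** D) ** (X ** Gmat)) *v u = ((transpose X ** D) ** (X ** Gmat)) *v w"
    by (simp only: matrix_vector_mul_assoc[symmetric])
  moreover have "(transpose X ** D) ** (X ** Gmat) = mat 1"
    using gram_eq_iff_left_inverse[OF assms(2)] assms(1) by blast
  ultimately show ?thesis
    by simp
qed

text \<open>Orthonormality determines the third vector only up to sign. The determinant settles the sign: it is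
minus the scalar product of the third vector with the vector product of the first two.\<close>

lemma third_row_eq_hcross:
  assumes "\<delta>1 \<in> {1, -1}" and "\<delta>2 \<in> {1, -1}"
    and gram: "X ** Gmat ** transpose X = signature_matrix \<delta>1 \<delta>2"
    and det: "det X = - (\<delta>1 * \<delta>2)"
  shows "X $ 3 = hcross (X $ 1) (X $ 2)"
proof (rule eq_if_hprod_rows_eq[OF gram signature_matrix_involution[OF assms(1,2)]])
  have X: "X = vector [X $ 1, X $ 2, X $ 3]"
    by (simp add: vec_eq_iff forall_3)
  have "hprod (X $ i) (X $ j) = signature_matrix \<delta>1 \<delta>2 $ i $ j" for i j
    using gram gram_entry by metis
  then have "hprod (X $ 1) (X $ 3) = 0" "hprod (X $ 2) (X $ 3) = 0"
      "hprod (X $ 3) (X $ 3) = \<delta>1 * \<delta>2"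
    by (simp_all add: signature_matrix_def)
  moreover have "hprod (X $ 3) (hcross (X $ 1) (X $ 2)) = \<delta>1 * \<delta>2"
    using hprod_hcross[of "X $ 1" "X $ 2" "X $ 3"] det X by (simp add: hprod_commute)
  ultimately have "\<forall>i. hprod (X $ i) (X $ 3) = hprod (X $ i) (hcross (X $ 1) (X $ 2))"
    by (simp add: forall_3 hprod_hcross_orthogonal)
  then show "hprod (X $ i) (X $ 3) = hprod (X $ i) (hcross (X $ 1) (X $ 2))" for i
    by blast
qed

lemma det_Gmat: "det Gmat = 1"
  by (simp add: Gmat_def det_3)

lemma det_signature_matrix: "det (signature_matrix \<delta>1 \<delta>2) = (\<delta>1 * \<delta>2)\<^sup>2"
  by (simp add: signature_matrix_def det_3 power2_eq_square)

text \<open>The basis \<open>i\<close>, \<open>i + \<epsilon>\<close>, \<open>h\<close> is orthonormal with squares \<open>1, -1, -1\<close>, so any two signs that are not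
both positive occur.\<close>

lemma orthonormal_pair_exists:
  assumes "\<delta>1 \<in> {1, -1}" and "\<delta>2 \<in> {1, -1}" and "(\<delta>1, \<delta>2) \<noteq> (1, 1)"
  shows "\<exists>x y. hprod x x = \<delta>1 \<and> hprod y y = \<delta>2 \<and> hprod x y = 0"
proof -
  let ?i = "vector [1, 0, 0] :: hvec" and ?e = "vector [1, 1, 0] :: hvec"
    and ?h = "vector [0, 0, 1] :: hvec"
  have "hprod ?i ?i = 1" "hprod ?e ?e = -1" "hprod ?h ?h = -1"
      "hprod ?i ?e = 0" "hprod ?e ?i = 0" "hprod ?e ?h = 0"
    by (simp_all add: hprod_def)
  then show ?thesis
    using assms by auto
qed

text \<open>The linear map taking the vectors of \<open>R\<close> to those of \<open>S\<close> satisfies \<open>A R\<^sup>T = S\<^sup>T\<close>, and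
\<open>D R G\<close> is the inverse of \<open>R\<^sup>T\<close> because \<open>R G R\<^sup>T = D\<close> and \<open>D\<^sup>2 = 1\<close>. It preserves the scalar product
since both frames have the same Gram matrix, and its determinant is the quotient of the two
determinants.\<close>

lemma hybrid_motion_of_frames:
  assumes "\<delta>1 \<in> {1, -1}" and "\<delta>2 \<in> {1, -1}"
    and R: "R ** Gmat ** transpose R = signature_matrix \<delta>1 \<delta>2"
    and S: "S ** Gmat ** transpose S = signature_matrix \<delta>1 \<delta>2"
    and "det R = det S"
  defines "A \<equiv> transpose S ** signature_matrix \<delta>1 \<delta>2 ** R ** Gmat"
  shows "A \<in> hybrid_motions" and "A *v (R $ i) = S $ i"
proof -
  let ?D = "signature_matrix \<delta>1 \<delta>2"
  note D = signature_matrix_involution[OF assms(1,2)]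
  have "A ** transpose R = transpose S ** (?D ** (R ** Gmat ** transpose R))"
    by (simp only: A_def matrix_mul_assoc)
  then have AR: "A ** transpose R = transpose S"
    by (simp add: R D)
  have row: "P $ i = transpose P *v axis i 1" for P :: "real^3^3"
    unfolding matrix_vector_mult_basis by (simp add: vec_eq_iff column_def transpose_def)
  show "A *v (R $ i) = S $ i"
    unfolding row[of R] row[of S] by (simp only: matrix_vector_mul_assoc AR)
  have "(det R)\<^sup>2 = det (R ** Gmat ** transpose R)"
    by (simp add: det_mul det_Gmat power2_eq_square)
  also have "\<dots> \<noteq> 0"
    unfolding R det_signature_matrix using assms(1,2) by auto
  finally have "det R \<noteq> 0"
    by simp
  have "det A * det R = det S"
    using arg_cong[OF AR, of det] by (simp add: det_mul)
  then have "det A = 1"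
    using \<open>det R = det S\<close> \<open>det R \<noteq> 0\<close> by simp
  have inv: "(transpose R ** ?D) ** (R ** Gmat) = mat 1"
    using gram_eq_iff_left_inverse[OF D] R by blast
  then have right: "transpose R ** (?D ** (R ** Gmat)) = mat 1"
    by (simp only: matrix_mul_assoc)
  have "(transpose R ** ?D ** R) ** Gmat = mat 1"
    using inv by (simp only: matrix_mul_assoc)
  then have "Gmat ** (transpose R ** ?D ** R) = mat 1"
    using matrix_left_right_inverse by blast
  then have left: "(Gmat ** (transpose R ** ?D)) ** R = mat 1"
    by (simp only: matrix_mul_assoc)
  \<comment> \<open>A matrix \<open>M\<close> is recovered from \<open>R M R\<^sup>T\<close>; applied below to \<open>A\<^sup>T G A\<close>.\<close>
  have cancel: "(Gmat ** (transpose R ** ?D)) ** (R ** M ** transpose R) ** (?D ** (R ** Gmat)) = M"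
    for M :: "real^3^3"
  proof -
    have "(Gmat ** (transpose R ** ?D)) ** (R ** M ** transpose R) ** (?D ** (R ** Gmat)) =
        ((Gmat ** (transpose R ** ?D)) ** R) ** M ** (transpose R ** (?D ** (R ** Gmat)))"
      by (simp only: matrix_mul_assoc)
    then show ?thesis
      by (simp only: left right matrix_mul_lid matrix_mul_rid)
  qed
  have RA: "R ** transpose A = S"
    using arg_cong[OF AR, of transpose] by (simp add: matrix_transpose_mul)
  have "R ** (transpose A ** Gmat ** A) ** transpose R =
      (R ** transpose A) ** Gmat ** (A ** transpose R)"
    by (simp only: matrix_mul_assoc)
  also have "\<dots> = R ** Gmat ** transpose R"
    by (simp only: RA AR R S)
  finally have "transpose A ** Gmat ** A = Gmat"
    using cancel by metis
  with \<open>det A = 1\<close> show "A \<in> hybrid_motions"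
    by (simp add: hybrid_motions_def)
qed

section \<open>Framed curves with prescribed curvature\<close>

text \<open>The curvature prescribes only three of the nine scalar products \<open>g(R'\<^sub>i, R\<^sub>j)\<close>. Differentiating the
constant products \<open>g(R\<^sub>i, R\<^sub>j)\<close> shows that this array is skew, which gives the remaining six. Comparing
with the array of \<open>C R\<close>, which is \<open>C D\<close>, identifies \<open>R'\<close> row by row.\<close>

lemma framed_curve_frenet_equations:
  assumes "perfect_on I" and sign: "\<delta>1 \<in> {1, -1}" "\<delta>2 \<in> {1, -1}"
    and curve: "realizes I (\<lambda>t. (l t, m t, n t, \<alpha> t)) \<delta>1 \<delta>2 \<gamma> \<nu>1 \<nu>2"
    and t: "t \<in> I"
  shows "((\<lambda>t. frame (\<nu>1 t) (\<nu>2 t)) has_vector_derivative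
           frenet_matrix \<delta>1 \<delta>2 (l t) (m t) (n t) ** frame (\<nu>1 t) (\<nu>2 t)) (at t within I)"
    and "(\<gamma> has_vector_derivative \<alpha> t *\<^sub>R hcross (\<nu>1 t) (\<nu>2 t)) (at t within I)"
proof -
  have smooth: "smooth_on I (\<lambda>t. (\<gamma> t, \<nu>1 t, \<nu>2 t))"
    and perp: "hprod (deriv_on I \<gamma> t) (\<nu>1 t) = 0" "hprod (deriv_on I \<gamma> t) (\<nu>2 t) = 0"
    and norm: "\<And>t. t \<in> I \<Longrightarrow> hprod (\<nu>1 t) (\<nu>1 t) = \<delta>1 \<and> hprod (\<nu>2 t) (\<nu>2 t) = \<delta>2 \<and>
      hprod (\<nu>1 t) (\<nu>2 t) = 0"
    and curv: "curvature I \<gamma> \<nu>1 \<nu>2 t = (l t, m t, n t, \<alpha> t)"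
    using curve t by (auto simp: realizes_def framed_curve_def Delta_def)
  define R where "R t = frame (\<nu>1 t) (\<nu>2 t)" for t
  define D where "D = signature_matrix \<delta>1 \<delta>2"
  let ?C = "frenet_matrix \<delta>1 \<delta>2 (l t) (m t) (n t)"
  have D: "D ** D = mat 1"
    unfolding D_def by (rule signature_matrix_involution[OF sign])
  have gram: "R t ** Gmat ** transpose (R t) = D" if "t \<in> I" for t
    unfolding R_def D_def using norm[OF that] by (intro gram_frame) auto
  have gram_ij: "hprod (R t $ i) (R t $ j) = D $ i $ j" if "t \<in> I" for t i j
    using gram[OF that] gram_entry by metis

  have "smooth_on I \<gamma>" "smooth_on I \<nu>1" "smooth_on I \<nu>2"
    using smooth_on_linear[OF assms(1) bounded_linear_fst smooth]
      smooth_on_linear[OF assms(1) bounded_linear_fst_comp[OF bounded_linear_snd] smooth]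
      smooth_on_linear[OF assms(1) bounded_linear_snd_comp[OF bounded_linear_snd] smooth]
    by simp_all
  then have deriv: "(\<gamma> has_vector_derivative deriv_on I \<gamma> t) (at t within I)"
    "(\<nu>1 has_vector_derivative deriv_on I \<nu>1 t) (at t within I)"
    "(\<nu>2 has_vector_derivative deriv_on I \<nu>2 t) (at t within I)"
    using t by (simp_all add: deriv_on_works smooth_on_imp_differentiable_on)
  define R' :: "real^3^3" where "R' = vector [deriv_on I \<nu>1 t, deriv_on I \<nu>2 t,
    hcross (\<nu>1 t) (deriv_on I \<nu>2 t) + hcross (deriv_on I \<nu>1 t) (\<nu>2 t)]"
  have R'_rows: "((\<lambda>t. R t $ i) has_vector_derivative R' $ i) (at t within I)" for i
  proof -
    have "\<forall>i. ((\<lambda>t. R t $ i) has_vector_derivative R' $ i) (at t within I)"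
      unfolding forall_3 R_def R'_def
      using deriv bounded_bilinear.has_vector_derivative[OF bounded_bilinear_hcross deriv(2,3)]
      by simp
    then show ?thesis ..
  qed
  have R': "(R has_vector_derivative R') (at t within I)"
    using R'_rows by (rule has_vector_derivative_rows)

  have skew: "hprod (R' $ j) (R t $ i) + hprod (R' $ i) (R t $ j) = 0" for i j
  proof -
    have product: "((\<lambda>t. hprod (R t $ i) (R t $ j)) has_vector_derivative
        hprod (R t $ i) (R' $ j) + hprod (R' $ i) (R t $ j)) (at t within I)"
      by (rule bounded_bilinear.has_vector_derivative[OF bounded_bilinear_hprod R'_rows R'_rows])
    have stationary: "((\<lambda>t. hprod (R t $ i) (R t $ j)) has_vector_derivative 0) (at t within I)"
      by (rule has_vector_derivative_transform[OF t, of _ "\<lambda>_. D $ i $ j"])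
        (simp_all add: gram_ij)
    show ?thesis
      using deriv_on_eq[OF assms(1) t product] deriv_on_eq[OF assms(1) t stationary]
      by (simp only: hprod_commute[of "R t $ i" "R' $ j"])
  qed
  have "\<delta>2 * hprod (R' $ 1) (R t $ 2) = l t" "\<delta>1 * \<delta>2 * hprod (R' $ 1) (R t $ 3) = m t"
    "\<delta>1 * \<delta>2 * hprod (R' $ 2) (R t $ 3) = n t"
    "\<delta>1 * \<delta>2 * hprod (deriv_on I \<gamma> t) (R t $ 3) = \<alpha> t"
    using curv norm[OF t] by (simp_all add: curvature_def Let_def R_def R'_def)
  then have S: "hprod (R' $ 1) (R t $ 2) = \<delta>2 * l t" "hprod (R' $ 1) (R t $ 3) = \<delta>1 * \<delta>2 * m t"
    "hprod (R' $ 2) (R t $ 3) = \<delta>1 * \<delta>2 * n t"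
    and \<gamma>'3: "hprod (deriv_on I \<gamma> t) (R t $ 3) = \<delta>1 * \<delta>2 * \<alpha> t"
    using sign by auto
  have "\<forall>i j. hprod (R' $ i) (R t $ j) = (?C ** D) $ i $ j"
    unfolding forall_3 D_def frenet_matrix_times_signature[OF sign]
    using S skew[of 1 1] skew[of 2 2] skew[of 3 3] skew[of 1 2] skew[of 1 3] skew[of 2 3]
    by simp
  moreover have "hprod ((?C ** R t) $ i) (R t $ j) = (?C ** D) $ i $ j" for i j
    unfolding gram_entry[symmetric] gram[OF t, symmetric] by (simp only: matrix_mul_assoc)
  ultimately have "hprod (R' $ i) (R t $ j) = hprod ((?C ** R t) $ i) (R t $ j)" for i j
    by simp
  then have "R' $ i = (?C ** R t) $ i" for i
    unfolding hprod_commute[of _ "R t $ _"]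
    by (intro eq_if_hprod_rows_eq[OF gram[OF t] D])
  then have "R' = ?C ** R t"
    by (simp add: vec_eq_iff)
  then show "((\<lambda>t. frame (\<nu>1 t) (\<nu>2 t)) has_vector_derivative
      ?C ** frame (\<nu>1 t) (\<nu>2 t)) (at t within I)"
    using R' by (simp add: R_def[abs_def])

  have scale: "hprod x (c *\<^sub>R y) = c * hprod x y" for x c y
    by (simp add: hprod_def algebra_simps)
  have "\<forall>i. hprod (R t $ i) (deriv_on I \<gamma> t) = hprod (R t $ i) (\<alpha> t *\<^sub>R R t $ 3)"
    unfolding forall_3 scale gram_ij[OF t]
    unfolding hprod_commute[of _ "deriv_on I \<gamma> t"]
    using perp \<gamma>'3 by (simp add: R_def D_def signature_matrix_def)
  then have "deriv_on I \<gamma> t = \<alpha> t *\<^sub>R R t $ 3"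
    using eq_if_hprod_rows_eq[OF gram[OF t] D] by blast
  then show "(\<gamma> has_vector_derivative \<alpha> t *\<^sub>R hcross (\<nu>1 t) (\<nu>2 t)) (at t within I)"
    using deriv(1) by (simp add: R_def)
qed

text \<open>The motion taking the frame \<open>R t\<close> of the first curve to the frame \<open>S t\<close> of the second is
\<open>S\<^sup>T D R G\<close> evaluated at \<open>t\<close>, which is constant by the conservation law for linear
equations with skew coefficients.
The translation part is constant because the base curve \<open>\<gamma>'\<close>
of the second framed curve and \<open>A \<gamma>\<close> have the same derivative \<open>\<alpha> S\<^sub>3\<close>.\<close>

theorem framed_curves_congruent:
  assumes I: "is_interval I" "perfect_on I" "I \<noteq> {}"
    and sign: "\<delta>1 \<in> {1, -1}" "\<delta>2 \<in> {1, -1}"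
    and curve: "realizes I (\<lambda>t. (l t, m t, n t, \<alpha> t)) \<delta>1 \<delta>2 \<gamma> \<nu>1 \<nu>2"
    and curve': "realizes I (\<lambda>t. (l t, m t, n t, \<alpha> t)) \<delta>1 \<delta>2 \<gamma>' \<nu>1' \<nu>2'"
  shows "congruent_curves I \<gamma> \<nu>1 \<nu>2 \<gamma>' \<nu>1' \<nu>2'"
proof -
  obtain t0 where t0: "t0 \<in> I"
    using I(3) by blast
  have convex: "convex I"
    using I(1) by (simp add: is_interval_convex)
  define D where "D = signature_matrix \<delta>1 \<delta>2"
  define R where "R t = frame (\<nu>1 t) (\<nu>2 t)" for t
  define S where "S t = frame (\<nu>1' t) (\<nu>2' t)" for t
  define A where "A = transpose (S t0) ** D ** R t0 ** Gmat"
  note frenet = framed_curve_frenet_equations[OF I(2) sign]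
  have "transpose (S t) ** D ** R t = transpose (S t0) ** D ** R t0" if "t \<in> I" for t
    unfolding S_def R_def D_def
    using frenet(1)[OF curve] frenet(1)[OF curve'] frenet_matrix_skew[OF sign] that t0
    by (intro linear_ode_pairing_constant[OF convex,
          where C = "\<lambda>t. frenet_matrix \<delta>1 \<delta>2 (l t) (m t) (n t)"]) auto
  then have A: "A = transpose (S t) ** D ** R t ** Gmat" if "t \<in> I" for t
    using that by (simp add: A_def)
  have orth: "hprod (\<nu>1 t) (\<nu>1 t) = \<delta>1" "hprod (\<nu>2 t) (\<nu>2 t) = \<delta>2" "hprod (\<nu>1 t) (\<nu>2 t) = 0"
      "hprod (\<nu>1' t) (\<nu>1' t) = \<delta>1" "hprod (\<nu>2' t) (\<nu>2' t) = \<delta>2" "hprod (\<nu>1' t) (\<nu>2' t) = 0"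
    if "t \<in> I" for t
    using curve curve' that by (auto simp: realizes_def framed_curve_def Delta_def)
  have gram: "R t ** Gmat ** transpose (R t) = D" "S t ** Gmat ** transpose (S t) = D"
    and det: "det (R t) = det (S t)" if "t \<in> I" for t
    unfolding R_def S_def D_def using orth[OF that] by (simp_all add: gram_frame det_frame)
  have motion: "A \<in> hybrid_motions" and A_rows: "\<And>i. A *v (R t $ i) = S t $ i" if "t \<in> I" for t
    using hybrid_motion_of_frames[OF sign gram[OF that, unfolded D_def] det[OF that]]
    unfolding A[OF that] D_def by blast+
  have "((\<lambda>t. \<gamma>' t - A *v \<gamma> t) has_vector_derivative 0) (at t within I)" if t: "t \<in> I" for t
  proof -
    have "((\<lambda>t. \<gamma>' t - A *v \<gamma> t) has_vector_derivative
        \<alpha> t *\<^sub>R S t $ 3 - A *v (\<alpha> t *\<^sub>R R t $ 3)) (at t within I)"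
      using frenet(2)[OF curve t] frenet(2)[OF curve' t]
      by (intro has_vector_derivative_diff
          bounded_linear.has_vector_derivative[OF matrix_vector_mul_bounded_linear])
        (simp_all add: R_def S_def)
    then show ?thesis
      by (simp add: A_rows[OF t] linear_cmul[OF matrix_vector_mul_linear])
  qed
  then obtain H0 where "\<And>t. t \<in> I \<Longrightarrow> \<gamma>' t - A *v \<gamma> t = H0"
    using has_vector_derivative_zero_constant[OF convex] by blast
  then have "\<gamma>' t = A *v \<gamma> t + H0 \<and> \<nu>1' t = A *v \<nu>1 t \<and> \<nu>2' t = A *v \<nu>2 t" if "t \<in> I" for t
    using that A_rows[OF that, of 1] A_rows[OF that, of 2]
    by (auto simp: R_def S_def algebra_simps)
  then show ?thesis
    unfolding congruent_curves_def using motion[OF t0] by blast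
qed

lemma frenet_matrix_smooth:
  assumes "perfect_on I" and "smooth_on I l" and "smooth_on I m" and "smooth_on I n"
  shows "smooth_on I (\<lambda>t. frenet_matrix \<delta>1 \<delta>2 (l t) (m t) (n t))"
proof -
  have "frenet_matrix \<delta>1 \<delta>2 a b c = a *\<^sub>R frenet_matrix \<delta>1 \<delta>2 1 0 0 +
      (b *\<^sub>R frenet_matrix \<delta>1 \<delta>2 0 1 0 + c *\<^sub>R frenet_matrix \<delta>1 \<delta>2 0 0 1)" for a b c
    by (simp add: frenet_matrix_def vec_eq_iff forall_3)
  then have split: "(\<lambda>t. frenet_matrix \<delta>1 \<delta>2 (l t) (m t) (n t)) =
      (\<lambda>t. l t *\<^sub>R frenet_matrix \<delta>1 \<delta>2 1 0 0 +
        (m t *\<^sub>R frenet_matrix \<delta>1 \<delta>2 0 1 0 + n t *\<^sub>R frenet_matrix \<delta>1 \<delta>2 0 0 1))"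
    by (intro ext)
  show ?thesis
    unfolding split
    by (intro smooth_on_add smooth_on_linear[OF assms(1) bounded_linear_scaleR_left] assms)
qed

text \<open>The Frenet equations are solved as a linear system in the nine unknown entries of the frame, with an
orthonormal initial value. The solution stays orthonormal by the conservation law. Its determinant then
takes only the values \<open>1\<close> and \<open>-1\<close>, so by continuity it keeps its initial value, and the
third row remains the vector product of the first two.\<close>

lemma moving_frame_exists:
  fixes I :: "real set" and l m n :: "real \<Rightarrow> real"
  assumes I: "is_interval I" "perfect_on I" "I \<noteq> {}"
    and smooth: "smooth_on I l" "smooth_on I m" "smooth_on I n"
    and sign: "\<delta>1 \<in> {1, -1}" "\<delta>2 \<in> {1, -1}" "(\<delta>1, \<delta>2) \<noteq> (1, 1)"
  shows "\<exists>X. smooth_on I X \<and>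
    (\<forall>t\<in>I. (X has_vector_derivative frenet_matrix \<delta>1 \<delta>2 (l t) (m t) (n t) ** X t) (at t within I) \<and>
      X t ** Gmat ** transpose (X t) = signature_matrix \<delta>1 \<delta>2 \<and>
      X t $ 3 = hcross (X t $ 1) (X t $ 2))"
proof -
  obtain t0 where t0: "t0 \<in> I"
    using I(3) by blast
  define C where "C t = frenet_matrix \<delta>1 \<delta>2 (l t) (m t) (n t)" for t
  define D where "D = signature_matrix \<delta>1 \<delta>2"
  have C: "smooth_on I C"
    unfolding C_def[abs_def] by (intro frenet_matrix_smooth I(2) smooth)
  have D: "D ** D = mat 1"
    unfolding D_def by (rule signature_matrix_involution[OF sign(1,2)])
  obtain x y where xy: "hprod x x = \<delta>1" "hprod y y = \<delta>2" "hprod x y = 0"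
    using orthonormal_pair_exists[OF sign] by blast
  obtain X where X0: "X t0 = frame x y"
    and X': "\<And>t. t \<in> I \<Longrightarrow> (X has_vector_derivative C t ** X t) (at t within I)"
    using linear_ode_solution_exists[OF bounded_bilinear_matrix_mult I(1) t0
        smooth_on_imp_continuous_on[OF C]] by blast
  have gram0: "X t0 ** Gmat ** transpose (X t0) = D"
    unfolding X0 D_def by (rule gram_frame[OF xy])
  have gram: "X t ** Gmat ** transpose (X t) = D" if t: "t \<in> I" for t
  proof -
    have "transpose (X t) ** D ** X t = transpose (X t0) ** D ** X t0"
    proof (rule linear_ode_pairing_constant[OF _ X' X' _ t t0])
      show "convex I"
        using I(1) by (simp add: is_interval_convex)
      show "transpose (C s) ** D + D ** C s = 0" for s
        unfolding C_def D_def by (rule frenet_matrix_skew[OF sign(1,2)])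
    qed auto
    then have "(transpose (X t) ** D) ** (X t ** Gmat) = (transpose (X t0) ** D) ** (X t0 ** Gmat)"
      by (simp only: matrix_mul_assoc)
    then show ?thesis
      using gram0 by (simp only: gram_eq_iff_left_inverse[OF D])
  qed
  have det_sq: "(det (X t))\<^sup>2 = 1" if "t \<in> I" for t
  proof -
    have "(det (X t))\<^sup>2 = det (X t ** Gmat ** transpose (X t))"
      by (simp add: det_mul det_Gmat power2_eq_square)
    also have "\<dots> = 1"
      unfolding gram[OF that] D_def det_signature_matrix using sign by auto
    finally show ?thesis .
  qed
  have "continuous_on I X"
    using X' has_vector_derivative_continuous
    unfolding continuous_on_eq_continuous_within by blast
  then have "continuous_on I (\<lambda>t. det (X t))"
    unfolding det_3 by (intro continuous_intros)
  moreover have "(\<lambda>t. det (X t)) ` I \<subseteq> {1, -1}"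
    using det_sq by (auto simp: power2_eq_1_iff)
  then have "finite ((\<lambda>t. det (X t)) ` I)"
    by (rule finite_subset) simp
  ultimately have "(\<lambda>t. det (X t)) constant_on I"
    by (intro continuous_finite_range_constant is_interval_connected I(1))
  then have det: "det (X t) = - (\<delta>1 * \<delta>2)" if "t \<in> I" for t
    using that t0 X0 det_frame[OF xy] unfolding constant_on_def by metis
  have "smooth_on I X"
    using smooth_on_linear_ode_solution[OF I(2) bounded_bilinear_matrix_mult C X'] .
  then show ?thesis
    using X' gram third_row_eq_hcross[OF sign(1,2) gram[unfolded D_def] det]
    unfolding C_def D_def by blast
qed

text \<open>The base curve is an antiderivative of \<open>\<alpha> \<mu>\<close>, so its tangent is orthogonal to \<open>\<nu>1\<close> and \<open>\<nu>2\<close>. The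
curvature is read off from the identity \<open>X' G X\<^sup>T = C X G X\<^sup>T = C D\<close>.\<close>

theorem framed_curve_exists:
  fixes I :: "real set" and l m n \<alpha> :: "real \<Rightarrow> real"
  assumes I: "is_interval I" "perfect_on I" "I \<noteq> {}"
    and smooth: "smooth_on I l" "smooth_on I m" "smooth_on I n" "smooth_on I \<alpha>"
    and sign: "\<delta>1 \<in> {1, -1}" "\<delta>2 \<in> {1, -1}" "(\<delta>1, \<delta>2) \<noteq> (1, 1)"
  shows "\<exists>\<gamma> \<nu>1 \<nu>2. realizes I (\<lambda>t. (l t, m t, n t, \<alpha> t)) \<delta>1 \<delta>2 \<gamma> \<nu>1 \<nu>2"
proof -
  define D where "D = signature_matrix \<delta>1 \<delta>2"
  obtain X where X: "smooth_on I X"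
    and X': "\<And>t. t \<in> I \<Longrightarrow>
      (X has_vector_derivative frenet_matrix \<delta>1 \<delta>2 (l t) (m t) (n t) ** X t) (at t within I)"
    and gram: "\<And>t. t \<in> I \<Longrightarrow> X t ** Gmat ** transpose (X t) = D"
    and third: "\<And>t. t \<in> I \<Longrightarrow> X t $ 3 = hcross (X t $ 1) (X t $ 2)"
    using moving_frame_exists[OF I smooth(1-3) sign] unfolding D_def by blast
  have row: "bounded_linear (\<lambda>M :: real^3^3. M $ i)" for i
    by (rule bounded_linear_vec_nth)
  have X_rows: "smooth_on I (\<lambda>t. X t $ i)" for i
    by (rule smooth_on_linear[OF I(2) row X])
  have \<gamma>'_smooth: "smooth_on I (\<lambda>t. \<alpha> t *\<^sub>R X t $ 3)"
    by (rule smooth_on_bilinear[OF I(2) bounded_bilinear_scaleR smooth(4) X_rows])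
  obtain t0 where "t0 \<in> I"
    using I(3) by blast
  then obtain \<gamma> where \<gamma>': "\<And>t. t \<in> I \<Longrightarrow> (\<gamma> has_vector_derivative \<alpha> t *\<^sub>R X t $ 3) (at t within I)"
    using antiderivative_on_interval[OF I(1) _ smooth_on_imp_continuous_on[OF \<gamma>'_smooth]] by blast
  have "smooth_on I \<gamma>"
    by (rule smooth_on_if_derivative_smooth[OF I(2) \<gamma>'_smooth \<gamma>'])
  then have smooth_curve: "smooth_on I (\<lambda>t. (\<gamma> t, X t $ 1, X t $ 2))"
    by (intro smooth_on_Pair I(2) X_rows)
  have scale: "hprod (c *\<^sub>R x) y = c * hprod x y" for x c y
    by (simp add: hprod_def algebra_simps)
  have "(X t $ 1, X t $ 2) \<in> Delta \<and> hprod (deriv_on I \<gamma> t) (X t $ 1) = 0 \<and>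
      hprod (deriv_on I \<gamma> t) (X t $ 2) = 0 \<and>
      curvature I \<gamma> (\<lambda>t. X t $ 1) (\<lambda>t. X t $ 2) t = (l t, m t, n t, \<alpha> t) \<and>
      hprod (X t $ 1) (X t $ 1) = \<delta>1 \<and> hprod (X t $ 2) (X t $ 2) = \<delta>2" if t: "t \<in> I" for t
  proof -
    let ?C = "frenet_matrix \<delta>1 \<delta>2 (l t) (m t) (n t)"
    have gram_ij: "hprod (X t $ i) (X t $ j) = D $ i $ j" for i j
      using gram[OF t] gram_entry by metis
    have "deriv_on I (\<lambda>t. X t $ i) t = (?C ** X t) $ i" for i
      by (intro deriv_on_eq[OF I(2) t] bounded_linear.has_vector_derivative[OF row] X'[OF t])
    then have "hprod (deriv_on I (\<lambda>t. X t $ i) t) (X t $ j) = (?C ** D) $ i $ j" for i j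
      unfolding gram[OF t, symmetric] matrix_mul_assoc by (simp only: gram_entry)
    then have frenet: "hprod (deriv_on I (\<lambda>t. X t $ 1) t) (X t $ 2) = \<delta>2 * l t"
      "hprod (deriv_on I (\<lambda>t. X t $ 1) t) (X t $ 3) = \<delta>1 * \<delta>2 * m t"
      "hprod (deriv_on I (\<lambda>t. X t $ 2) t) (X t $ 3) = \<delta>1 * \<delta>2 * n t"
      by (simp_all add: D_def frenet_matrix_times_signature[OF sign(1,2)])
    have "deriv_on I \<gamma> t = \<alpha> t *\<^sub>R X t $ 3"
      by (rule deriv_on_eq[OF I(2) t \<gamma>'[OF t]])
    then have tangent: "hprod (deriv_on I \<gamma> t) (X t $ i) = \<alpha> t * D $ 3 $ i" for i
      by (simp only: scale gram_ij)
    show ?thesis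
      using sign
      by (auto simp: Delta_def hnorm_def curvature_def Let_def gram_ij tangent frenet
          third[OF t, symmetric] D_def signature_matrix_def)
  qed
  with smooth_curve have "realizes I (\<lambda>t. (l t, m t, n t, \<alpha> t)) \<delta>1 \<delta>2 \<gamma> (\<lambda>t. X t $ 1) (\<lambda>t. X t $ 2)"
    by (simp add: realizes_def framed_curve_def)
  then show ?thesis
    by blast
qed

theorem theorem3p6:
  fixes I :: "real set" and l m n \<alpha> :: "real \<Rightarrow> real" and \<delta>1 \<delta>2 :: real
  assumes "is_interval I" and "interior I \<noteq> {}"
    and "smooth_on I l" and "smooth_on I m" and "smooth_on I n" and "smooth_on I \<alpha>"
    and "\<delta>1 \<in> {1, -1}" and "\<delta>2 \<in> {1, -1}"
  shows "((\<delta>1, \<delta>2) \<noteq> (1, 1) \<longrightarrow>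
           (\<exists>\<gamma> \<nu>1 \<nu>2. realizes I (\<lambda>t. (l t, m t, n t, \<alpha> t)) \<delta>1 \<delta>2 \<gamma> \<nu>1 \<nu>2)) \<and>
         (\<forall>\<gamma> \<nu>1 \<nu>2 \<gamma>' \<nu>1' \<nu>2'.
           realizes I (\<lambda>t. (l t, m t, n t, \<alpha> t)) \<delta>1 \<delta>2 \<gamma> \<nu>1 \<nu>2 \<longrightarrow>
           realizes I (\<lambda>t. (l t, m t, n t, \<alpha> t)) \<delta>1 \<delta>2 \<gamma>' \<nu>1' \<nu>2' \<longrightarrow>
           congruent_curves I \<gamma> \<nu>1 \<nu>2 \<gamma>' \<nu>1' \<nu>2')"
proof -
  have "perfect_on I" and "I \<noteq> {}"
    using assms(1,2) perfect_on_interval by auto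
  then show ?thesis
    using framed_curve_exists[OF assms(1) _ _ assms(3-8)]
      framed_curves_congruent[OF assms(1) _ _ assms(7,8)] by blast
qed

end
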